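(* Consider a stagewise independent multistage stochastic program with the regularization, standing assumptions and deterministic sampling dual dynamic programming algorithm described in the context. Suppose there is a positive integer $K$ such that the cardinality $|\mathcal X_t|\le K<\infty$ for all $0\le t\le T-1$. Let $\epsilon>0$. If the algorithm with tolerance $\epsilon$ terminates with an $\epsilon$-optimal root node solution $(x_0^*,y_0^* )$, then the iteration index $i$ at termination satisfies $i\le TK$.
   Context: **Problem.** $T\ge1$. For each stage $t=1,\dots,T$ there is a finite set $\tilde{\mathcal N}(t)$ of distinct nodes; $\tilde{\mathcal N}(0)=\{r\}$. Node $m\in\tilde{\mathcal N}(t)$, $t\ge1$, is realized with probability $p_{t-1,m}>0$ independently of the past, $\sum_{m\in\tilde{\mathcal N}(t)}p_{t-1,m}=1$. Each node $m\in\tilde{\mathcal N}(t)$ has a compact set $\mathcal F_m$ of pairs $(x,y)$ in a Euclidean space, and for $t\le T-1$ its projection onto the $x$-coordinates is the same set $\mathcal X_t\subset\mathbb R^{d_t}$ for all $m\in\tilde{\mathcal N}(t)$; $\mathcal X_{-1}=\{0\}$ and $x_{-1}=0$. The cost $f_m(z,y,x)\in[0,+\infty]$, defined for $z\in\mathcal X_{t-1}$, $(x,y)\in\mathcal F_m$, is lower semicontinuous. The scenario tree has as stage-$t$ nodes the sequences $n=(n_1,\dots,n_t)$, $n_s\in\tilde{\mathcal N}(s)$ (the root being the empty sequence), with the data of $n_t$, probability $p_n=\prod_{s\le t}p_{s-1,n_s}$ and parent $a(n)=(n_1,\dots,n_{t-1})$; the original problem is to minimize $\sum_n p_nf_n(x_{a(n)},y_n,x_n)$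 over $(x_n,y_n)\in\mathcal F_n$ for all tree nodes $n$, and it is assumed to have a feasible solution with finite objective. Fix a norm $\|\cdot\|$ with dual norm $\|\cdot\|_*$. **Regularization.** A penalty function is $\psi:\mathbb R^d\to\mathbb R_+$ with $\psi(x)=0$ iff $x=0$ and with the diameter of $\{\psi\le a\}$ tending to $0$ as $a\to0$. For each $m\in\tilde{\mathcal N}(t)$ a penalty function $\psi_m$, 1-Lipschitz on $\mathcal X_{t-1}-\mathcal X_{t-1}$, and $\sigma_m>0$ are given. With $\mathcal Q_T^{\mathrm R}\equiv0$ and $\mathcal Q_t^{\mathrm R}(x)=\sum_{m\in\tilde{\mathcal N}(t+1)}p_{t,m}Q_m^{\mathrm R}(x)$ for $t<T$, define for $m\in\tilde{\mathcal N}(t)$ $$Q_m^{\mathrm R}(x_{t-1})=\min_{(x,y)\in\mathcal F_m,\ z\in\mathcal X_{t-1}}\{f_m(z,y,x)+\sigma_m\psi_m(x_{t-1}-z)+\mathcal Q_t^{\mathrm R}(x)\}.$$ $v^{\mathrm{reg}}=\min_{(x,y)\in\mathcal F_r}\{f_r(0,y,x)+\mathcal Q_0^{\mathrm R}(x)\}$; $(x_0,y_0)\in\mathcal F_r$ is an $\epsilon$-optimal root node solution if $f_r(0,y_0,x_0)+\mathcal Q_0^{\mathrm R}(x_0)\le v^{\mathrm{reg}}+\epsilon$. Standing assumption (exactness): every optimal solution of the problem of minimizing $\sum_n p_n(f_n(z_n,y_n,x_n)+\sigma_n\psi_n(x_{a(n)}-z_n))$ over $(x_n,y_n)\in\mathcal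 F_n$, $z_n\in\mathcal X_{t(n)-1}$ for all scenario tree nodes $n$ (where $t(n)$ is the stage of $n$) satisfies $z_n=x_{a(n)}$ for all $n$. The problem is called convex if all $\mathcal F_m,f_m,\psi_m$ are convex. For $m\neq r$ let $\mathcal U_m=\{(\lambda,\rho):\|\lambda\|_*\le l_{m,\lambda},\ 0\le\rho\le l_{m,\rho}\}$ with given nonnegative bounds satisfying $l_{m,\lambda}\ge\sigma_m,\ l_{m,\rho}=0$ in the convex case with $\psi_m=\|\cdot\|$, and $l_{m,\rho}\ge\sigma_m$ otherwise. **Deterministic sampling algorithm with tolerance $\epsilon$.** "An optimal solution" means any optimal solution returned by a given oracle. Initialize $\underline{\mathcal Q}_t^0\equiv0$ for all $t$, $\overline{\mathcal Q}_t^0\equiv+\infty$ for $t\le T-1$, and $\underline{\mathcal Q}_T^i\equiv\overline{\mathcal Q}_T^i\equiv0$ for all $i$. Let $(x_0^1,y_0^1)$ be an optimal solution of $\min_{(x,y)\in\mathcal F_r}f_r(0,y,x)$, $\mathrm{LB}=f_r(0,y_0^1,x_0^1)$, $\mathrm{UB}=+\infty$. For $i=1,2,\dots$, while $\mathrm{UB}-\mathrm{LB}>\epsilon$, iteration $i$ is: (Forward) for $t=1,\dots,T$: for each $n\in\tilde{\mathcal N}(t)$, $(x_n^i,y_n^i,z_n^i)$ is an optimal solution of $\min_{(x,y)\in\mathcal F_n,z\in\mathcal X_{t-1}}\{f_n(z,y,x)+\sigma_n\psi_n(x_{t-1}^i-z)+\underline{\mathcal Q}_t^{i-1}(x)\}$;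 if $t\le T-1$, let $\gamma_n^i=\overline{\mathcal Q}_t^{i-1}(x_n^i)-\underline{\mathcal Q}_t^{i-1}(x_n^i)$, select any $n^*\in\tilde{\mathcal N}(t)$ with $\gamma_{n^*}^i\ge\gamma_n^i$ for all $n\in\tilde{\mathcal N}(t)$, and set $x_t^i=x_{n^*}^i$. (Backward) for $t=T,\dots,1$: if $t<T$, set $\underline{\mathcal Q}_t^i(x)=\max\{\underline{\mathcal Q}_t^{i-1}(x),\sum_{m\in\tilde{\mathcal N}(t+1)}p_{t,m}C_m^i(x)\}$ and let $\overline{\mathcal Q}_t^i$ be $\mathrm{conv}\{\overline{\mathcal Q}_t^{i-1},h_t^i\}$ in the convex case and $\min\{\overline{\mathcal Q}_t^{i-1},h_t^i\}$ otherwise, where $h_t^i(x)=\sum_{m\in\tilde{\mathcal N}(t+1)}p_{t,m}(\bar v_m^i+\sigma_m\|x-x_t^i\|)$ and $\mathrm{conv}\{f,g\}$ is the convex biconjugate of $\min\{f,g\}$ on $\mathbb R^{d_t}$. Then for each $n\in\tilde{\mathcal N}(t)$ let $\underline v_n^i$ be the optimal value and $(\hat\lambda_n^i,\hat\rho_n^i)$ an optimal outer solution of $\max_{(\lambda,\rho)\in\mathcal U_n}\min_{(x,y)\in\mathcal F_n,z\in\mathcal X_{t-1}}\{f_n(z,y,x)+\langle\lambda,x_{t-1}^i-z\rangle+\rho\psi_n(x_{t-1}^i-z)+\underline{\mathcal Q}_t^i(x)\}$; set $C_n^i(x)=-\langle\hat\lambda_n^i,x_{t-1}^i-x\rangle-\hat\rho_n^i\psi_n(x_{t-1}^i-x)+\underline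 v_n^i$ and $\bar v_n^i=f_n(z_n^i,y_n^i,x_n^i)+\sigma_n\psi_n(x_{t-1}^i-z_n^i)+\overline{\mathcal Q}_t^i(x_n^i)$. (Root) update $\underline{\mathcal Q}_0^i,\overline{\mathcal Q}_0^i$ by the same formulas with $t=0$; let $(x_0^{i+1},y_0^{i+1})$ be an optimal solution of $\min_{(x,y)\in\mathcal F_r}\{f_r(0,y,x)+\underline{\mathcal Q}_0^i(x)\}$; set $\mathrm{LB}=f_r(0,y_0^{i+1},x_0^{i+1})+\underline{\mathcal Q}_0^i(x_0^{i+1})$; if $\mathrm{UB}>f_r(0,y_0^{i+1},x_0^{i+1})+\overline{\mathcal Q}_0^i(x_0^{i+1})$, set $\mathrm{UB}$ to this value and $(x_0^*,y_0^* )=(x_0^{i+1},y_0^{i+1})$. *)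

theory Defs
  imports "HOL-Analysis.Analysis"
begin

section \<open>Convex analysis on a Euclidean space and its subspaces\<close>

definition lsc_on :: "'a::topological_space set \<Rightarrow> ('a \<Rightarrow> ereal) \<Rightarrow> bool" where
  "lsc_on S f \<longleftrightarrow> (\<forall>x\<in>S. f x \<le> Liminf (at x within S) f)"

text \<open>Convexity of a function with values in $[0,\infty]$. Since $0\cdot\infty = 0$ in
  \<^typ>\<open>ereal\<close>, the weights 0 and 1 are unproblematic.\<close>

definition convex_on_ereal :: "'a::real_vector set \<Rightarrow> ('a \<Rightarrow> ereal) \<Rightarrow> bool" where
  "convex_on_ereal S f \<longleftrightarrow> convex S \<and>
     (\<forall>x\<in>S. \<forall>y\<in>S. \<forall>u\<ge>0. \<forall>v\<ge>0. u + v = 1 \<longrightarrow>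
        f (u *\<^sub>R x + v *\<^sub>R y) \<le> ereal u * f x + ereal v * f y)"

definition norm_on :: "'a::real_vector set \<Rightarrow> ('a \<Rightarrow> real) \<Rightarrow> bool" where
  "norm_on E N \<longleftrightarrow>
     (\<forall>x\<in>E. 0 \<le> N x \<and> (N x = 0 \<longleftrightarrow> x = 0)) \<and>
     (\<forall>x\<in>E. \<forall>c. N (c *\<^sub>R x) = \<bar>c\<bar> * N x) \<and>
     (\<forall>x\<in>E. \<forall>y\<in>E. N (x + y) \<le> N x + N y)"

definition dual_norm :: "'a::euclidean_space set \<Rightarrow> ('a \<Rightarrow> real) \<Rightarrow> 'a \<Rightarrow> real" where
  "dual_norm E N l = (SUP x\<in>{x\<in>E. N x \<le> 1}. l \<bullet> x)"

definition conjugate_on :: "'a::euclidean_space set \<Rightarrow> ('a \<Rightarrow> ereal) \<Rightarrow> 'a \<Rightarrow> ereal" where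
  "conjugate_on E g l = (SUP x\<in>E. ereal (l \<bullet> x) - g x)"

definition biconjugate_on :: "'a::euclidean_space set \<Rightarrow> ('a \<Rightarrow> ereal) \<Rightarrow> 'a \<Rightarrow> ereal" where
  "biconjugate_on E g x = (SUP l\<in>E. ereal (l \<bullet> x) - conjugate_on E g l)"

text \<open>Boundedness of the level sets is spelled out because \<^const>\<open>diameter\<close> is a real number and
  meaningless for unbounded sets.\<close>

definition penalty_on :: "'a::euclidean_space set \<Rightarrow> ('a \<Rightarrow> real) \<Rightarrow> bool" where
  "penalty_on E \<psi> \<longleftrightarrow>
     (\<forall>x\<in>E. 0 \<le> \<psi> x \<and> (\<psi> x = 0 \<longleftrightarrow> x = 0)) \<and>
     (\<forall>\<^sub>F a in at_right 0. bounded {x\<in>E. \<psi> x \<le> a}) \<and>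
     ((\<lambda>a. diameter {x\<in>E. \<psi> x \<le> a}) \<longlongrightarrow> 0) (at_right 0)"


section \<open>Stagewise independent multistage stochastic programs\<close>

text \<open>The state spaces $\mathbb R^{d_t}$, whose dimensions vary with the stage, are rendered as
  arbitrary linear subspaces \<open>E t\<close> of one ambient Euclidean space \<^typ>\<open>'a\<close> of arbitrary dimension;
  likewise the node-dependent spaces of the variables \<open>y\<close> sit inside \<^typ>\<open>'b\<close>.
  The given norm is a family \<open>nrm t\<close>, a norm on \<open>E t\<close> for each stage.
  \<open>prob t m\<close> is $p_{t,m}$, for a node \<open>m\<close> of stage \<open>t + 1\<close>, and \<open>cost m z y x\<close> is $f_m(z,y,x)$.\<close>

record ('n, 'a, 'b) msp =
  horizon :: nat
  nodes   :: "nat \<Rightarrow> 'n set"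
  root    :: 'n
  prob    :: "nat \<Rightarrow> 'n \<Rightarrow> real"
  E       :: "nat \<Rightarrow> 'a set"
  nrm     :: "nat \<Rightarrow> 'a \<Rightarrow> real"
  states  :: "nat \<Rightarrow> 'a set"
  feas    :: "'n \<Rightarrow> ('a \<times> 'b) set"
  cost    :: "'n \<Rightarrow> 'a \<Rightarrow> 'b \<Rightarrow> 'a \<Rightarrow> ereal"
  pen     :: "'n \<Rightarrow> 'a \<Rightarrow> real"
  sig     :: "'n \<Rightarrow> real"
  lam_bd  :: "'n \<Rightarrow> real"
  rho_bd  :: "'n \<Rightarrow> real"

text \<open>Space and set of the states entering stage \<open>t\<close>: $\mathbb R^{d_{t-1}}$ and
  $\mathcal X_{t-1}$, where the initial state space is trivial and $\mathcal X_{-1}=\{0\}$.\<close>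

definition prev_E :: "('n, 'a::euclidean_space, 'b::euclidean_space) msp \<Rightarrow> nat \<Rightarrow> 'a set" where
  "prev_E P t = (if t = 0 then {0} else E P (t - 1))"

definition prev_states :: "('n, 'a::euclidean_space, 'b::euclidean_space) msp \<Rightarrow> nat \<Rightarrow> 'a set" where
  "prev_states P t = (if t = 0 then {0} else states P (t - 1))"

text \<open>Scenario tree nodes are lists; the root is the empty list and the parent is \<^const>\<open>butlast\<close>.\<close>

definition tree :: "('n, 'a::euclidean_space, 'b::euclidean_space) msp \<Rightarrow> 'n list set" where
  "tree P = {n. length n \<le> horizon P \<and> (\<forall>s<length n. n ! s \<in> nodes P (Suc s))}"

definition tree_prob :: "('n, 'a::euclidean_space, 'b::euclidean_space) msp \<Rightarrow> 'n list \<Rightarrow> real" where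
  "tree_prob P n = (\<Prod>s<length n. prob P s (n ! s))"

definition tree_data :: "('n, 'a::euclidean_space, 'b::euclidean_space) msp \<Rightarrow> 'n list \<Rightarrow> 'n" where
  "tree_data P n = (if n = [] then root P else last n)"

definition parent_state :: "('n list \<Rightarrow> 'a::zero) \<Rightarrow> 'n list \<Rightarrow> 'a" where
  "parent_state x n = (if n = [] then 0 else x (butlast n))"

definition tree_feasible ::
  "('n, 'a::euclidean_space, 'b::euclidean_space) msp \<Rightarrow> ('n list \<Rightarrow> 'a) \<Rightarrow> ('n list \<Rightarrow> 'b) \<Rightarrow> bool" where
  "tree_feasible P x y \<longleftrightarrow> (\<forall>n\<in>tree P. (x n, y n) \<in> feas P (tree_data P n))"

definition tree_objective ::
  "('n, 'a::euclidean_space, 'b::euclidean_space) msp \<Rightarrow> ('n list \<Rightarrow> 'a) \<Rightarrow> ('n list \<Rightarrow> 'b) \<Rightarrow> ereal" where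
  "tree_objective P x y =
     (\<Sum>n\<in>tree P. ereal (tree_prob P n) * cost P (tree_data P n) (parent_state x n) (y n) (x n))"

definition msp_problem :: "('n, 'a::euclidean_space, 'b::euclidean_space) msp \<Rightarrow> bool" where
  "msp_problem P \<longleftrightarrow>
     1 \<le> horizon P \<and>
     nodes P 0 = {root P} \<and>
     (\<forall>t\<le>horizon P. finite (nodes P t)) \<and>
     (\<forall>s\<le>horizon P. \<forall>t\<le>horizon P. s \<noteq> t \<longrightarrow> nodes P s \<inter> nodes P t = {}) \<and>
     (\<forall>t<horizon P. (\<forall>m\<in>nodes P (t + 1). 0 < prob P t m) \<and> (\<Sum>m\<in>nodes P (t + 1). prob P t m) = 1) \<and>
     (\<forall>t<horizon P. subspace (E P t) \<and> norm_on (E P t) (nrm P t) \<and> states P t \<subseteq> E P t) \<and>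
     (\<forall>t\<le>horizon P. \<forall>m\<in>nodes P t. compact (feas P m)) \<and>
     (\<forall>t<horizon P. \<forall>m\<in>nodes P t. fst ` feas P m = states P t) \<and>
     (\<forall>t\<le>horizon P. \<forall>m\<in>nodes P t.
        (\<forall>z\<in>prev_states P t. \<forall>(x, y)\<in>feas P m. 0 \<le> cost P m z y x) \<and>
        lsc_on (prev_states P t \<times> feas P m) (\<lambda>(z, x, y). cost P m z y x)) \<and>
     (\<exists>x y. tree_feasible P x y \<and> tree_objective P x y < \<infinity>)"


section \<open>Regularization\<close>

definition regularization :: "('n, 'a::euclidean_space, 'b::euclidean_space) msp \<Rightarrow> bool" where
  "regularization P \<longleftrightarrow>
     (\<forall>t\<le>horizon P. \<forall>m\<in>nodes P t. penalty_on (prev_E P t) (pen P m) \<and> 0 < sig P m) \<and>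
     (\<forall>t<horizon P. \<forall>m\<in>nodes P (t + 1).
        \<forall>u\<in>{a - b | a b. a \<in> states P t \<and> b \<in> states P t}.
        \<forall>v\<in>{a - b | a b. a \<in> states P t \<and> b \<in> states P t}.
          \<bar>pen P m u - pen P m v\<bar> \<le> nrm P t (u - v))"

text \<open>The regularized objective of stage node \<open>m\<close> at the decision \<open>((x, y), z)\<close>, for incoming
  state \<open>x'\<close> and cost-to-go function \<open>V\<close>.\<close>

definition stage_obj ::
  "('n, 'a::euclidean_space, 'b::euclidean_space) msp \<Rightarrow> 'n \<Rightarrow> 'a \<Rightarrow> ('a \<Rightarrow> ereal) \<Rightarrow> ('a \<times> 'b) \<times> 'a \<Rightarrow> ereal" where
  "stage_obj P m x' V = (\<lambda>((x, y), z). cost P m z y x + ereal (sig P m * pen P m (x' - z)) + V x)"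

text \<open>\<open>regQ_togo P k\<close> is $\mathcal Q^{\mathrm R}_{T-k}$.\<close>

primrec regQ_togo :: "('n, 'a::euclidean_space, 'b::euclidean_space) msp \<Rightarrow> nat \<Rightarrow> 'a \<Rightarrow> ereal" where
  "regQ_togo P 0 = (\<lambda>x. 0)"
| "regQ_togo P (Suc k) = (\<lambda>x'. \<Sum>m\<in>nodes P (horizon P - k).
     ereal (prob P (horizon P - Suc k) m) *
     (INF w\<in>feas P m \<times> prev_states P (horizon P - k). stage_obj P m x' (regQ_togo P k) w))"

definition regQ :: "('n, 'a::euclidean_space, 'b::euclidean_space) msp \<Rightarrow> nat \<Rightarrow> 'a \<Rightarrow> ereal" where
  "regQ P t = regQ_togo P (horizon P - t)"

definition root_obj ::
  "('n, 'a::euclidean_space, 'b::euclidean_space) msp \<Rightarrow> ('a \<Rightarrow> ereal) \<Rightarrow> 'a \<times> 'b \<Rightarrow> ereal" where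
  "root_obj P V = (\<lambda>(x, y). cost P (root P) 0 y x + V x)"

definition v_reg :: "('n, 'a::euclidean_space, 'b::euclidean_space) msp \<Rightarrow> ereal" where
  "v_reg P = (INF w\<in>feas P (root P). root_obj P (regQ P 0) w)"

definition eps_optimal_root ::
  "('n, 'a::euclidean_space, 'b::euclidean_space) msp \<Rightarrow> real \<Rightarrow> 'a \<times> 'b \<Rightarrow> bool" where
  "eps_optimal_root P eps w \<longleftrightarrow>
     w \<in> feas P (root P) \<and> root_obj P (regQ P 0) w \<le> v_reg P + ereal eps"

definition reg_tree_feasible ::
  "('n, 'a::euclidean_space, 'b::euclidean_space) msp \<Rightarrow>
   ('n list \<Rightarrow> 'a) \<times> ('n list \<Rightarrow> 'b) \<times> ('n list \<Rightarrow> 'a) \<Rightarrow> bool" where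
  "reg_tree_feasible P = (\<lambda>(x, y, z).
     \<forall>n\<in>tree P. (x n, y n) \<in> feas P (tree_data P n) \<and> z n \<in> prev_states P (length n))"

definition reg_tree_objective ::
  "('n, 'a::euclidean_space, 'b::euclidean_space) msp \<Rightarrow>
   ('n list \<Rightarrow> 'a) \<times> ('n list \<Rightarrow> 'b) \<times> ('n list \<Rightarrow> 'a) \<Rightarrow> ereal" where
  "reg_tree_objective P = (\<lambda>(x, y, z).
     \<Sum>n\<in>tree P. ereal (tree_prob P n) *
       (cost P (tree_data P n) (z n) (y n) (x n) +
        ereal (sig P (tree_data P n) * pen P (tree_data P n) (parent_state x n - z n))))"

definition exact_regularization :: "('n, 'a::euclidean_space, 'b::euclidean_space) msp \<Rightarrow> bool" where
  "exact_regularization P \<longleftrightarrow>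
     (\<forall>x y z. is_arg_min (reg_tree_objective P) (reg_tree_feasible P) (x, y, z) \<longrightarrow>
        (\<forall>n\<in>tree P. z n = parent_state x n))"

definition convex_problem :: "('n, 'a::euclidean_space, 'b::euclidean_space) msp \<Rightarrow> bool" where
  "convex_problem P \<longleftrightarrow>
     (\<forall>t\<le>horizon P. \<forall>m\<in>nodes P t.
        convex (feas P m) \<and>
        convex_on_ereal (prev_states P t \<times> feas P m) (\<lambda>(z, x, y). cost P m z y x) \<and>
        convex_on (prev_E P t) (pen P m))"

definition dual_bounds :: "('n, 'a::euclidean_space, 'b::euclidean_space) msp \<Rightarrow> bool" where
  "dual_bounds P \<longleftrightarrow>
     (\<forall>t<horizon P. \<forall>m\<in>nodes P (t + 1).
        0 \<le> lam_bd P m \<and> 0 \<le> rho_bd P m \<and>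
        (if convex_problem P \<and> (\<forall>x\<in>E P t. pen P m x = nrm P t x)
         then sig P m \<le> lam_bd P m \<and> rho_bd P m = 0
         else sig P m \<le> rho_bd P m))"

text \<open>$\mathcal U_m$ for a node \<open>m\<close> of stage \<open>t \<ge> 1\<close>\<close>

definition dual_set ::
  "('n, 'a::euclidean_space, 'b::euclidean_space) msp \<Rightarrow> nat \<Rightarrow> 'n \<Rightarrow> ('a \<times> real) set" where
  "dual_set P t m =
     {(l, \<rho>). l \<in> E P (t - 1) \<and> dual_norm (E P (t - 1)) (nrm P (t - 1)) l \<le> lam_bd P m \<and>
              0 \<le> \<rho> \<and> \<rho> \<le> rho_bd P m}"

definition dual_value ::
  "('n, 'a::euclidean_space, 'b::euclidean_space) msp \<Rightarrow> nat \<Rightarrow> 'n \<Rightarrow> 'a \<Rightarrow> ('a \<Rightarrow> ereal) \<Rightarrow> 'a \<times> real \<Rightarrow> ereal" where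
  "dual_value P t m x' V = (\<lambda>(l, \<rho>).
     INF ((x, y), z)\<in>feas P m \<times> prev_states P t.
       cost P m z y x + ereal (l \<bullet> (x' - z) + \<rho> * pen P m (x' - z)) + V x)"


section \<open>Deterministic sampling dual dynamic programming\<close>

text \<open>The record of a run. The first argument of each component is the iteration index.
  \<open>state R i t\<close> is $x_t^i$; \<open>y_root R i\<close> is $y_0^i$; \<open>fwd R i n\<close> is $((x_n^i,y_n^i),z_n^i)$;
  \<open>Q_lo R i t\<close> and \<open>Q_up R i t\<close> are the approximations $\underline{\mathcal Q}_t^i$ and
  $\overline{\mathcal Q}_t^i$; \<open>v_lo R i n\<close> and \<open>dual_sol R i n\<close> are $\underline v_n^i$ and
  $(\hat\lambda_n^i,\hat\rho_n^i)$. \<open>LB R i\<close>, \<open>UB R i\<close> and \<open>incumbent R i\<close>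
  (the pair $(x_0^*,y_0^*)$) are the values after iteration \<open>i\<close>, with \<open>i = 0\<close> for initialization;
  \<open>incumbent R 0\<close> is arbitrary.\<close>

record ('n, 'a, 'b) ddp_run =
  state     :: "nat \<Rightarrow> nat \<Rightarrow> 'a"
  y_root    :: "nat \<Rightarrow> 'b"
  fwd       :: "nat \<Rightarrow> 'n \<Rightarrow> ('a \<times> 'b) \<times> 'a"
  Q_lo      :: "nat \<Rightarrow> nat \<Rightarrow> 'a \<Rightarrow> ereal"
  Q_up      :: "nat \<Rightarrow> nat \<Rightarrow> 'a \<Rightarrow> ereal"
  v_lo      :: "nat \<Rightarrow> 'n \<Rightarrow> ereal"
  dual_sol  :: "nat \<Rightarrow> 'n \<Rightarrow> 'a \<times> real"
  LB        :: "nat \<Rightarrow> ereal"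
  UB        :: "nat \<Rightarrow> ereal"
  incumbent :: "nat \<Rightarrow> 'a \<times> 'b"

definition fwd_x :: "('n, 'a::euclidean_space, 'b::euclidean_space) ddp_run \<Rightarrow> nat \<Rightarrow> 'n \<Rightarrow> 'a" where
  "fwd_x R i n = fst (fst (fwd R i n))"

definition gap :: "('n, 'a::euclidean_space, 'b::euclidean_space) ddp_run \<Rightarrow> nat \<Rightarrow> nat \<Rightarrow> 'n \<Rightarrow> ereal" where
  "gap R i t n = Q_up R (i - 1) t (fwd_x R i n) - Q_lo R (i - 1) t (fwd_x R i n)"

text \<open>\<open>cut P R i t n\<close> is $C_n^i$ and \<open>v_up P R i t n\<close> is $\bar v_n^i$, for a node \<open>n\<close> of stage
  \<open>t \<ge> 1\<close>.\<close>

definition cut ::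
  "('n, 'a::euclidean_space, 'b::euclidean_space) msp \<Rightarrow> ('n, 'a, 'b) ddp_run \<Rightarrow>
   nat \<Rightarrow> nat \<Rightarrow> 'n \<Rightarrow> 'a \<Rightarrow> ereal" where
  "cut P R i t n x =
     ereal (- (fst (dual_sol R i n) \<bullet> (state R i (t - 1) - x))
            - snd (dual_sol R i n) * pen P n (state R i (t - 1) - x)) + v_lo R i n"

definition v_up ::
  "('n, 'a::euclidean_space, 'b::euclidean_space) msp \<Rightarrow> ('n, 'a, 'b) ddp_run \<Rightarrow>
   nat \<Rightarrow> nat \<Rightarrow> 'n \<Rightarrow> ereal" where
  "v_up P R i t n = stage_obj P n (state R i (t - 1)) (Q_up R i t) (fwd R i n)"

definition upper_cut ::
  "('n, 'a::euclidean_space, 'b::euclidean_space) msp \<Rightarrow> ('n, 'a, 'b) ddp_run \<Rightarrow>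
   nat \<Rightarrow> nat \<Rightarrow> 'a \<Rightarrow> ereal" where
  "upper_cut P R i t x = (\<Sum>m\<in>nodes P (t + 1).
     ereal (prob P t m) * (v_up P R i (t + 1) m + ereal (sig P m * nrm P t (x - state R i t))))"

definition ddp_init ::
  "('n, 'a::euclidean_space, 'b::euclidean_space) msp \<Rightarrow> ('n, 'a, 'b) ddp_run \<Rightarrow> bool" where
  "ddp_init P R \<longleftrightarrow>
     (\<forall>t\<le>horizon P. \<forall>x. Q_lo R 0 t x = 0) \<and>
     (\<forall>t<horizon P. \<forall>x. Q_up R 0 t x = \<infinity>) \<and>
     (\<forall>i x. Q_lo R i (horizon P) x = 0 \<and> Q_up R i (horizon P) x = 0) \<and>
     is_arg_min (root_obj P (\<lambda>x. 0)) (\<lambda>w. w \<in> feas P (root P)) (state R 1 0, y_root R 1) \<and>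
     LB R 0 = root_obj P (\<lambda>x. 0) (state R 1 0, y_root R 1) \<and>
     UB R 0 = \<infinity>"

definition ddp_forward ::
  "('n, 'a::euclidean_space, 'b::euclidean_space) msp \<Rightarrow> ('n, 'a, 'b) ddp_run \<Rightarrow> nat \<Rightarrow> bool" where
  "ddp_forward P R i \<longleftrightarrow>
     (\<forall>t\<in>{1..horizon P}. \<forall>n\<in>nodes P t.
        is_arg_min (stage_obj P n (state R i (t - 1)) (Q_lo R (i - 1) t))
          (\<lambda>w. w \<in> feas P n \<times> prev_states P t) (fwd R i n)) \<and>
     (\<forall>t\<in>{1..<horizon P}. \<exists>m\<in>nodes P t.
        (\<forall>n\<in>nodes P t. gap R i t n \<le> gap R i t m) \<and> state R i t = fwd_x R i m)"

text \<open>The update for \<open>t = 0\<close> is the one made in the root step. The conjuncts are not circular: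
  the approximations of stage \<open>t\<close> only use dual and upper values of stage \<open>t + 1\<close>.\<close>

definition ddp_backward ::
  "('n, 'a::euclidean_space, 'b::euclidean_space) msp \<Rightarrow> ('n, 'a, 'b) ddp_run \<Rightarrow> nat \<Rightarrow> bool" where
  "ddp_backward P R i \<longleftrightarrow>
     (\<forall>t<horizon P. \<forall>x\<in>E P t.
        Q_lo R i t x =
          max (Q_lo R (i - 1) t x)
              (\<Sum>m\<in>nodes P (t + 1). ereal (prob P t m) * cut P R i (t + 1) m x) \<and>
        Q_up R i t x =
          (let g = (\<lambda>x. min (Q_up R (i - 1) t x) (upper_cut P R i t x))
           in if convex_problem P then biconjugate_on (E P t) g x else g x)) \<and>
     (\<forall>t\<in>{1..horizon P}. \<forall>n\<in>nodes P t.
        v_lo R i n = (SUP u\<in>dual_set P t n. dual_value P t n (state R i (t - 1)) (Q_lo R i t) u) \<and>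
        dual_sol R i n \<in> dual_set P t n \<and>
        dual_value P t n (state R i (t - 1)) (Q_lo R i t) (dual_sol R i n) = v_lo R i n)"

definition ddp_root_step ::
  "('n, 'a::euclidean_space, 'b::euclidean_space) msp \<Rightarrow> ('n, 'a, 'b) ddp_run \<Rightarrow> nat \<Rightarrow> bool" where
  "ddp_root_step P R i \<longleftrightarrow>
     (let w = (state R (i + 1) 0, y_root R (i + 1)); u = root_obj P (Q_up R i 0) w in
        is_arg_min (root_obj P (Q_lo R i 0)) (\<lambda>w. w \<in> feas P (root P)) w \<and>
        LB R i = root_obj P (Q_lo R i 0) w \<and>
        (if UB R (i - 1) > u then UB R i = u \<and> incumbent R i = w
         else UB R i = UB R (i - 1) \<and> incumbent R i = incumbent R (i - 1)))"

text \<open>\<open>R\<close> records a run with tolerance \<open>eps\<close> that executes exactly the iterations \<open>1, \<dots>, i\<close> and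
  terminates after iteration \<open>i\<close>.\<close>

definition ddp_terminates ::
  "('n, 'a::euclidean_space, 'b::euclidean_space) msp \<Rightarrow> real \<Rightarrow> ('n, 'a, 'b) ddp_run \<Rightarrow> nat \<Rightarrow> bool" where
  "ddp_terminates P eps R i \<longleftrightarrow>
     ddp_init P R \<and>
     (\<forall>j\<in>{1..i}. UB R (j - 1) - LB R (j - 1) > ereal eps \<and>
        ddp_forward P R j \<and> ddp_backward P R j \<and> ddp_root_step P R j) \<and>
     \<not> UB R i - LB R i > ereal eps"

end

theory Submission
  imports Defs
begin

text \<open>Call a state \<open>x\<close> of stage \<open>t\<close> resolved after iteration \<open>j\<close> if the approximations of
  stage \<open>t\<close> differ by at most \<open>eps\<close> at \<open>x\<close>. Since the approximations are monotone in \<open>j\<close>, resolved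
  states stay resolved. As long as the algorithm runs, the current root state is unresolved, while
  everything is resolved at the last stage. At the last unresolved stage of the forward pass, the
  selection rule makes all forward states of the next stage resolved, and then the backward step
  resolves the current state. Hence each iteration resolves a new pair of stage and state.

  The backward step needs the dual problems to attain the optimal values of the forward problems.
  The multiplier $(0,\sigma)$ is a witness of that, except in the convex case with norm penalty.
  There a finite state set, being convex, is a singleton, so that penalties vanish.\<close>

section \<open>Zero multiplier, biconjugates and finite convex sets\<close>

lemma dual_norm_zero:
  assumes "subspace S" "norm_on S N"
  shows "dual_norm S N 0 = 0"
proof -
  have "0 \<in> S" using assms(1) by (rule subspace_0)
  moreover from this have "N 0 = 0" using assms(2) by (simp add: norm_on_def)
  ultimately have "0 \<in> {x\<in>S. N x \<le> 1}" by simp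
  \<comment> \<open>\<open>dual_norm\<close> is a supremum of reals, so the set must not be empty:
    the vector 0 in the unit ball makes the image \<open>{0}\<close>.\<close>
  then have "(\<lambda>x. (0::'a) \<bullet> x) ` {x\<in>S. N x \<le> 1} = {0}"
    by auto
  then show ?thesis
    by (simp add: dual_norm_def)
qed

text \<open>Fenchel-Young inequality. The case distinction carries the rearrangement through
  infinite values.\<close>

lemma biconjugate_on_le:
  assumes "x \<in> S"
  shows "biconjugate_on S g x \<le> g x"
  unfolding biconjugate_on_def
proof (rule SUP_least)
  fix l
  have "ereal (l \<bullet> x) - g x \<le> conjugate_on S g l"
    unfolding conjugate_on_def using assms by (rule SUP_upper)
  then show "ereal (l \<bullet> x) - conjugate_on S g l \<le> g x"
    by (cases "g x"; cases "conjugate_on S g l") (auto simp: algebra_simps)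
qed

text \<open>Convex sets are connected, and a finite connected set has at most one point.\<close>

lemma finite_convex_eq:
  fixes S :: "'a::real_normed_vector set"
  assumes "finite S" "convex S" "a \<in> S" "b \<in> S"
  shows "a = b"
  using assms convex_connected[of S] connected_finite_iff_sing[of S] by auto

section \<open>Scenario tree and decisions of finite cost\<close>

lemma
  assumes "msp_problem P"
  shows msp_problem_stages: "\<forall>t<horizon P. (\<forall>m\<in>nodes P (t + 1). 0 < prob P t m) \<and>
      (\<Sum>m\<in>nodes P (t + 1). prob P t m) = 1"
    and msp_problem_spaces:
      "\<forall>t<horizon P. subspace (E P t) \<and> norm_on (E P t) (nrm P t) \<and> states P t \<subseteq> E P t"
    and msp_problem_states: "\<forall>t<horizon P. \<forall>m\<in>nodes P t. fst ` feas P m = states P t"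
    and msp_problem_costs: "\<forall>t\<le>horizon P. \<forall>m\<in>nodes P t.
        (\<forall>z\<in>prev_states P t. \<forall>(x, y)\<in>feas P m. 0 \<le> cost P m z y x) \<and>
        lsc_on (prev_states P t \<times> feas P m) (\<lambda>(z, x, y). cost P m z y x)"
    and msp_problem_feasible: "\<exists>x y. tree_feasible P x y \<and> tree_objective P x y < \<infinity>"
    and msp_problem_horizon: "1 \<le> horizon P"
    and msp_problem_root: "nodes P 0 = {root P}"
    and msp_problem_finite: "\<forall>t\<le>horizon P. finite (nodes P t)"
  using assms unfolding msp_problem_def by - (elim conjE, assumption)+

lemma finite_tree:
  assumes "msp_problem P"
  shows "finite (tree P)"
proof (rule finite_subset)
  show "tree P \<subseteq> {n. set n \<subseteq> (\<Union>s\<le>horizon P. nodes P s) \<and> length n \<le> horizon P}"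
    by (fastforce simp: tree_def in_set_conv_nth)
  show "finite {n. set n \<subseteq> (\<Union>s\<le>horizon P. nodes P s) \<and> length n \<le> horizon P}"
    using msp_problem_finite[OF assms] by (intro finite_lists_length_le) auto
qed

lemma tree_data_in_nodes:
  assumes "msp_problem P" "n \<in> tree P"
  shows "tree_data P n \<in> nodes P (length n)"
proof (cases n rule: rev_cases)
  case Nil
  then show ?thesis using msp_problem_root[OF assms(1)] by (simp add: tree_data_def)
next
  case (snoc k m)
  then show ?thesis using assms(2) by (auto simp: tree_data_def tree_def)
qed

lemma butlast_in_tree: "n \<in> tree P \<Longrightarrow> butlast n \<in> tree P"
  by (auto simp: tree_def nth_butlast)

lemma prob_pos:
  assumes "msp_problem P" "t < horizon P" "m \<in> nodes P (Suc t)"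
  shows "0 < prob P t m"
  using msp_problem_stages[OF assms(1)] assms(2,3) by simp

lemma nodes_nonempty:
  assumes "msp_problem P" "t \<le> horizon P"
  shows "nodes P t \<noteq> {}"
proof (cases t)
  case 0
  then show ?thesis using msp_problem_root[OF assms(1)] by simp
next
  case (Suc s)
  then have "(\<Sum>m\<in>nodes P t. prob P s m) = 1"
    using msp_problem_stages[OF assms(1)] assms(2) by simp
  then show ?thesis by auto
qed

lemma parent_state_in_prev_states:
  assumes P: "msp_problem P" and feas: "tree_feasible P x y" and n: "n \<in> tree P"
  shows "parent_state x n \<in> prev_states P (length n)"
proof (cases "n = []")
  case True
  then show ?thesis by (simp add: parent_state_def prev_states_def)
next
  case False
  have b: "butlast n \<in> tree P" using n by (rule butlast_in_tree)
  have len: "length n - 1 < horizon P"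
    using n False by (cases n) (auto simp: tree_def)
  have "x (butlast n) \<in> fst ` feas P (tree_data P (butlast n))"
    using feas b by (force simp: tree_feasible_def)
  moreover have "tree_data P (butlast n) \<in> nodes P (length n - 1)"
    using tree_data_in_nodes[OF P b] by simp
  ultimately have "x (butlast n) \<in> states P (length n - 1)"
    using msp_problem_states[OF P] len by auto
  then show ?thesis using False by (simp add: parent_state_def prev_states_def)
qed

text \<open>Earlier stages are nonempty, as their probabilities sum to one, so \<open>m\<close> can
  be preceded by arbitrary nodes of those stages. This carries finiteness of the tree objective to
  every stage node.\<close>

lemma node_on_tree:
  assumes P: "msp_problem P" and t: "t \<le> horizon P" and m: "m \<in> nodes P t"
  obtains n where "n \<in> tree P" "length n = t" "tree_data P n = m"
proof (cases t)
  case 0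
  then show ?thesis using that[of "[]"] msp_problem_root[OF P] m by (simp add: tree_def tree_data_def)
next
  case (Suc s)
  define c where "c k = (SOME q. q \<in> nodes P k)" for k
  have c: "c k \<in> nodes P k" if "k \<le> horizon P" for k
    using nodes_nonempty[OF P that] by (auto simp: c_def some_in_eq)
  let ?n = "map (\<lambda>k. c (Suc k)) [0..<s] @ [m]"
  show ?thesis
    using that[of ?n] Suc t m c by (auto simp: tree_def tree_data_def nth_append less_Suc_eq)
qed

text \<open>Take the assumed feasible solution of finite objective at a tree node carrying
  \<open>m\<close>. An infinite cost there would make the whole sum infinite. Positivity of the
  probability matters because 0 times infinity is 0 in \<open>ereal\<close>.\<close>

lemma finite_cost_decision:
  assumes P: "msp_problem P" and t: "t \<le> horizon P" and m: "m \<in> nodes P t"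
  obtains x y z where "(x, y) \<in> feas P m" "z \<in> prev_states P t" "cost P m z y x < \<infinity>"
proof -
  obtain x y where feas: "tree_feasible P x y" and fin: "tree_objective P x y < \<infinity>"
    using msp_problem_feasible[OF P] by blast
  obtain n where n: "n \<in> tree P" "length n = t" "tree_data P n = m"
    using node_on_tree[OF P t m] .
  have "0 < tree_prob P n"
    unfolding tree_prob_def
  proof (rule prod_pos)
    fix s assume "s \<in> {..<length n}"
    then show "0 < prob P s (n ! s)"
      using n(1) by (intro prob_pos[OF P]) (simp_all add: tree_def)
  qed
  moreover have "ereal (tree_prob P n) * cost P m (parent_state x n) (y n) (x n) \<noteq> \<infinity>"
  proof
    assume "ereal (tree_prob P n) * cost P m (parent_state x n) (y n) (x n) = \<infinity>"
    then have "tree_objective P x y = \<infinity>"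
      unfolding tree_objective_def sum_Pinfty using n finite_tree[OF P] by blast
    then show False using fin by simp
  qed
  ultimately have "cost P m (parent_state x n) (y n) (x n) < \<infinity>"
    by (cases "cost P m (parent_state x n) (y n) (x n)") auto
  then show ?thesis
    using that[of "x n" "y n" "parent_state x n"] feas n
      parent_state_in_prev_states[OF P feas n(1)]
    by (auto simp: tree_feasible_def)
qed

text \<open>All states, where the last stage, which has no state set, is unrestricted.\<close>

definition stage_states :: "('n, 'a::euclidean_space, 'b::euclidean_space) msp \<Rightarrow> nat \<Rightarrow> 'a set" where
  "stage_states P t = (if t < horizon P then states P t else UNIV)"

section \<open>A run on finite state sets\<close>

locale finite_state_run =
  fixes P :: "('n, 'a::euclidean_space, 'b::euclidean_space) msp"
    and R :: "('n, 'a, 'b) ddp_run"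
    and last_iter :: nat
    and eps :: real
  assumes problem: "msp_problem P"
    and reg: "regularization P"
    and bounds: "dual_bounds P"
    and finite_states: "t < horizon P \<Longrightarrow> finite (states P t)"
    and eps_pos: "0 < eps"
    and run: "ddp_terminates P eps R last_iter"
begin

abbreviation "iterations \<equiv> {1..last_iter}"

lemma init: "ddp_init P R"
  and forward: "j \<in> iterations \<Longrightarrow> ddp_forward P R j"
  and backward: "j \<in> iterations \<Longrightarrow> ddp_backward P R j"
  and root_step: "j \<in> iterations \<Longrightarrow> ddp_root_step P R j"
  and not_stopped: "j \<in> iterations \<Longrightarrow> ereal eps < UB R (j - 1) - LB R (j - 1)"
  using run by (auto simp: ddp_terminates_def)

lemma horizon_pos: "0 < horizon P"
  using msp_problem_horizon[OF problem] by simp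

lemma states_subset: "t < horizon P \<Longrightarrow> states P t \<subseteq> E P t"
  and subspace_E: "t < horizon P \<Longrightarrow> subspace (E P t)"
  and norm_on_E: "t < horizon P \<Longrightarrow> norm_on (E P t) (nrm P t)"
  using msp_problem_spaces[OF problem] by simp_all

lemma sum_prob: "t < horizon P \<Longrightarrow> (\<Sum>m\<in>nodes P (Suc t). prob P t m) = 1"
  using msp_problem_stages[OF problem] by simp

lemma root_in: "root P \<in> nodes P 0"
  using msp_problem_root[OF problem] by simp

lemma fst_feas: "t < horizon P \<Longrightarrow> m \<in> nodes P t \<Longrightarrow> fst ` feas P m = states P t"
  using msp_problem_states[OF problem] by simp

lemma feas_stage_states:
  assumes "t \<le> horizon P" "m \<in> nodes P t" "w \<in> feas P m"
  shows "fst w \<in> stage_states P t"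
  using fst_feas[of t m] assms by (auto simp: stage_states_def)

lemma cost_nonneg:
  assumes "t \<le> horizon P" "m \<in> nodes P t" "z \<in> prev_states P t" "(x, y) \<in> feas P m"
  shows "0 \<le> cost P m z y x"
  using msp_problem_costs[OF problem] assms by blast

lemma penalty_on_pen: "t < horizon P \<Longrightarrow> m \<in> nodes P (Suc t) \<Longrightarrow> penalty_on (E P t) (pen P m)"
  and sig_pos: "t < horizon P \<Longrightarrow> m \<in> nodes P (Suc t) \<Longrightarrow> 0 < sig P m"
  using reg[unfolded regularization_def, THEN conjunct1, rule_format, of "Suc t" m]
  by (simp_all add: prev_E_def)

lemma pen_nonneg:
  assumes "t < horizon P" "m \<in> nodes P (Suc t)" "x \<in> states P t" "z \<in> states P t"
  shows "0 \<le> sig P m * pen P m (x - z)"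
proof -
  have "x - z \<in> E P t"
    using subspace_diff[OF subspace_E[OF assms(1)]] states_subset[OF assms(1)] assms by blast
  then show ?thesis
    using penalty_on_pen[OF assms(1,2)] sig_pos[OF assms(1,2)] by (simp add: penalty_on_def)
qed

lemma pen_zero:
  assumes "t < horizon P" "m \<in> nodes P (Suc t)"
  shows "pen P m 0 = 0"
  using penalty_on_pen[OF assms] subspace_0[OF subspace_E[OF assms(1)]]
  by (simp add: penalty_on_def)

lemma nrm_zero: "t < horizon P \<Longrightarrow> nrm P t 0 = 0"
  using norm_on_E[of t] subspace_0[OF subspace_E] by (auto simp: norm_on_def)

text \<open>The state set is the projection of a convex feasible set, hence convex as well as
  finite.\<close>

lemma states_singleton:
  assumes "convex_problem P" "t < horizon P" "x \<in> states P t" "z \<in> states P t"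
  shows "x = z"
proof -
  obtain m where m: "m \<in> nodes P t"
    using nodes_nonempty[OF problem, of t] assms by auto
  then have "convex (feas P m)"
    using assms(1)[unfolded convex_problem_def, rule_format, of t m] assms(2) by simp
  then have "convex (states P t)"
    using convex_linear_image[OF linear_fst] fst_feas[OF assms(2) m] by metis
  then show ?thesis
    using finite_convex_eq finite_states assms by blast
qed

section \<open>Monotone approximations and trial states\<close>

lemma Q_lo_horizon [simp]: "Q_lo R j (horizon P) x = 0"
  and Q_up_horizon [simp]: "Q_up R j (horizon P) x = 0"
  using init by (auto simp: ddp_init_def)

lemma Q_lo_step:
  assumes "j \<in> iterations" "t < horizon P" "x \<in> states P t"
  shows "Q_lo R j t x = max (Q_lo R (j - 1) t x)
           (\<Sum>m\<in>nodes P (Suc t). ereal (prob P t m) * cut P R j (Suc t) m x)"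
  using backward[OF assms(1)] states_subset[OF assms(2)] assms by (auto simp: ddp_backward_def)

text \<open>An inequality, because the convex case takes a biconjugate, which lies below the
  minimum. This is the direction in which states get resolved.\<close>

lemma Q_up_step:
  assumes "j \<in> iterations" "t < horizon P" "x \<in> states P t"
  shows "Q_up R j t x \<le> min (Q_up R (j - 1) t x) (upper_cut P R j t x)"
proof -
  have x: "x \<in> E P t" using states_subset assms by auto
  let ?g = "\<lambda>x. min (Q_up R (j - 1) t x) (upper_cut P R j t x)"
  have "Q_up R j t x = (if convex_problem P then biconjugate_on (E P t) ?g x else ?g x)"
    using backward[OF assms(1)] x assms by (auto simp: ddp_backward_def Let_def)
  then show ?thesis using biconjugate_on_le[OF x, of ?g] by auto
qed

lemma Q_lo_mono:
  assumes "j \<in> iterations" "t \<le> horizon P" "x \<in> stage_states P t"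
  shows "Q_lo R (j - 1) t x \<le> Q_lo R j t x"
  using assms Q_lo_step[of j t x] by (cases "t = horizon P") (auto simp: stage_states_def)

lemma Q_up_antimono:
  assumes "j \<in> iterations" "t \<le> horizon P" "x \<in> stage_states P t"
  shows "Q_up R j t x \<le> Q_up R (j - 1) t x"
  using assms Q_up_step[of j t x] by (cases "t = horizon P") (auto simp: stage_states_def)

lemma fwd_arg_min:
  assumes "j \<in> iterations" "t < horizon P" "n \<in> nodes P (Suc t)"
  shows "is_arg_min (stage_obj P n (state R j t) (Q_lo R (j - 1) (Suc t)))
           (\<lambda>w. w \<in> feas P n \<times> states P t) (fwd R j n)"
  using bspec[OF conjunct1[OF forward[OF assms(1), unfolded ddp_forward_def]], of "Suc t"] assms
  by (auto simp: prev_states_def)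

lemma fwd_x_stage_states:
  assumes "j \<in> iterations" "t < horizon P" "n \<in> nodes P (Suc t)"
  shows "fwd_x R j n \<in> stage_states P (Suc t)"
  using fwd_arg_min[OF assms] feas_stage_states[of "Suc t" n "fst (fwd R j n)"] assms
  by (auto simp: is_arg_min_def fwd_x_def mem_Times_iff)

text \<open>The root solution used in iteration \<open>j\<close> comes from the initialization if
  \<open>j = 1\<close> and from the root step of iteration \<open>j - 1\<close> otherwise. Both have
  one form since \<open>Q_lo R 0 0\<close> vanishes.\<close>

lemma root_arg_min:
  assumes "j \<in> iterations"
  shows "is_arg_min (root_obj P (Q_lo R (j - 1) 0)) (\<lambda>w. w \<in> feas P (root P))
           (state R j 0, y_root R j)"
    and "LB R (j - 1) = root_obj P (Q_lo R (j - 1) 0) (state R j 0, y_root R j)"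
proof -
  have *: "is_arg_min (root_obj P (Q_lo R (j - 1) 0)) (\<lambda>w. w \<in> feas P (root P))
             (state R j 0, y_root R j) \<and>
           LB R (j - 1) = root_obj P (Q_lo R (j - 1) 0) (state R j 0, y_root R j)"
  proof (cases "j = 1")
    case True
    moreover have "Q_lo R 0 0 = (\<lambda>x. 0)" using init by (auto simp: ddp_init_def)
    ultimately show ?thesis using init by (simp add: ddp_init_def)
  next
    case False
    then have "j - 1 \<in> iterations" "j - 1 + 1 = j" using assms by auto
    then show ?thesis using root_step[of "j - 1"] by (auto simp: ddp_root_step_def Let_def)
  qed
  then show "is_arg_min (root_obj P (Q_lo R (j - 1) 0)) (\<lambda>w. w \<in> feas P (root P))
           (state R j 0, y_root R j)"
    and "LB R (j - 1) = root_obj P (Q_lo R (j - 1) 0) (state R j 0, y_root R j)"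
    by blast+
qed

lemma state_in_states:
  assumes "j \<in> iterations" "t < horizon P"
  shows "state R j t \<in> states P t"
proof (cases t)
  case 0
  then show ?thesis
    using root_arg_min(1)[OF assms(1)] fst_feas[OF assms(2), of "root P"] root_in
    by (force simp: is_arg_min_def)
next
  case (Suc s)
  then obtain m where m: "m \<in> nodes P t" "state R j t = fwd_x R j m"
    using bspec[OF conjunct2[OF forward[OF assms(1), unfolded ddp_forward_def]], of t] assms
    by auto
  then show ?thesis
    using fwd_x_stage_states[of j s m] assms Suc by (simp add: stage_states_def)
qed

section \<open>Dual values dominate forward values and are finite\<close>

lemma v_lo_dual:
  assumes "j \<in> iterations" "t < horizon P" "n \<in> nodes P (Suc t)"
  shows "v_lo R j n =
      (SUP u\<in>dual_set P (Suc t) n. dual_value P (Suc t) n (state R j t) (Q_lo R j (Suc t)) u)"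
    and "v_lo R j n = dual_value P (Suc t) n (state R j t) (Q_lo R j (Suc t)) (dual_sol R j n)"
proof -
  have "Suc t \<in> {1..horizon P}" using assms(2) by simp
  from bspec[OF bspec[OF conjunct2[OF backward[OF assms(1), unfolded ddp_backward_def]] this] assms(3)]
  show "v_lo R j n =
      (SUP u\<in>dual_set P (Suc t) n. dual_value P (Suc t) n (state R j t) (Q_lo R j (Suc t)) u)"
    and "v_lo R j n = dual_value P (Suc t) n (state R j t) (Q_lo R j (Suc t)) (dual_sol R j n)"
    unfolding diff_Suc_1 by (blast intro: sym)+
qed

text \<open>Strong duality for the forward problems, in the only direction that is needed.\<close>

lemma fwd_value_le_v_lo:
  assumes j: "j \<in> iterations" and t: "t < horizon P" and n: "n \<in> nodes P (Suc t)"
  shows "stage_obj P n (state R j t) (Q_lo R (j - 1) (Suc t)) (fwd R j n) \<le> v_lo R j n"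
proof -
  let ?x = "state R j t"
  have x: "?x \<in> states P t" using j t by (rule state_in_states)
  \<comment> \<open>The multiplier \<open>(0, \<rho>)\<close> shall reproduce the penalty term of
    the forward problem. The bounds allow \<open>\<rho> = sig P n\<close> except in the convex case
    with norm penalty; there \<open>\<rho> = 0\<close> serves, as \<open>?x\<close> is the only
    state and both sides vanish.\<close>
  obtain \<rho> where \<rho>: "0 \<le> \<rho>" "\<rho> \<le> rho_bd P n"
    and pen: "\<And>z. z \<in> states P t \<Longrightarrow> \<rho> * pen P n (?x - z) = sig P n * pen P n (?x - z)"
  proof (cases "convex_problem P \<and> (\<forall>x\<in>E P t. pen P n x = nrm P t x)")
    case True
    then have "rho_bd P n = 0" using bounds t n by (auto simp: dual_bounds_def)
    moreover have "pen P n (?x - z) = 0" if "z \<in> states P t" for z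
      using states_singleton[OF _ t x that] True pen_zero[OF t n] by simp
    ultimately show ?thesis using that[of 0] by simp
  next
    case False
    then have "sig P n \<le> rho_bd P n"
      using bounds t n unfolding dual_bounds_def by (metis Suc_eq_plus1)
    then show ?thesis using that[of "sig P n"] sig_pos[OF t n] by simp
  qed
  have "0 \<le> lam_bd P n" using bounds t n by (auto simp: dual_bounds_def)
  then have dual: "(0, \<rho>) \<in> dual_set P (Suc t) n"
    using \<rho> subspace_0[OF subspace_E[OF t]] dual_norm_zero[OF subspace_E[OF t] norm_on_E[OF t]]
    by (simp add: dual_set_def)
  have "stage_obj P n ?x (Q_lo R (j - 1) (Suc t)) (fwd R j n)
        \<le> dual_value P (Suc t) n ?x (Q_lo R j (Suc t)) (0, \<rho>)"
    unfolding dual_value_def prod.case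
  proof (rule INF_greatest)
    fix w assume "w \<in> feas P n \<times> prev_states P (Suc t)"
    then obtain x y z where w: "w = ((x, y), z)" "(x, y) \<in> feas P n" "z \<in> states P t"
      by (auto simp: prev_states_def)
    \<comment> \<open>The dual problem uses the approximation of iteration \<open>j\<close>, the
      forward problem that of \<open>j - 1\<close>. Minimality of the forward solution and
      monotonicity bridge the two.\<close>
    have "stage_obj P n ?x (Q_lo R (j - 1) (Suc t)) (fwd R j n)
          \<le> stage_obj P n ?x (Q_lo R (j - 1) (Suc t)) w"
      using fwd_arg_min[OF j t n] w by (auto simp: is_arg_min_linorder)
    also have "\<dots> \<le> stage_obj P n ?x (Q_lo R j (Suc t)) w"
      using Q_lo_mono[OF j, of "Suc t" x] feas_stage_states[of "Suc t" n "(x, y)"] t n w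
      by (auto simp: stage_obj_def intro!: add_mono)
    finally show "stage_obj P n ?x (Q_lo R (j - 1) (Suc t)) (fwd R j n)
        \<le> (case w of (xa, z) \<Rightarrow> (case xa of (x, y) \<Rightarrow> \<lambda>z. cost P n z y x +
            ereal (0 \<bullet> (?x - z) + \<rho> * pen P n (?x - z)) + Q_lo R j (Suc t) x) z)"
      unfolding w(1) prod.case pen[OF w(3)] by (simp add: stage_obj_def[of _ _ _ "Q_lo R j _"])
  qed
  also have "\<dots> \<le> (SUP u\<in>dual_set P (Suc t) n. dual_value P (Suc t) n ?x (Q_lo R j (Suc t)) u)"
    using dual by (rule SUP_upper)
  also have "\<dots> = v_lo R j n"
    using v_lo_dual(1)[OF j t n] by simp
  finally show ?thesis .
qed

text \<open>The value at the returned \<open>dual_sol\<close> is an infimum, hence bounded by its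
  term at one decision of finite cost. Attainment replaces a bound uniform over all
  multipliers.\<close>

lemma v_lo_finite:
  assumes j: "j \<in> iterations" and t: "t < horizon P" and n: "n \<in> nodes P (Suc t)"
    and fin: "\<And>x. x \<in> stage_states P (Suc t) \<Longrightarrow> Q_lo R j (Suc t) x < \<infinity>"
  shows "v_lo R j n < \<infinity>"
proof -
  obtain x y z where w: "(x, y) \<in> feas P n" "z \<in> prev_states P (Suc t)" "cost P n z y x < \<infinity>"
    using finite_cost_decision[OF problem _ n] t by auto
  obtain l \<rho> where sol: "dual_sol R j n = (l, \<rho>)" by fastforce
  have "v_lo R j n = dual_value P (Suc t) n (state R j t) (Q_lo R j (Suc t)) (l, \<rho>)"
    using v_lo_dual(2)[OF j t n] sol by simp
  also have "\<dots> \<le> cost P n z y x +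
      ereal (l \<bullet> (state R j t - z) + \<rho> * pen P n (state R j t - z)) + Q_lo R j (Suc t) x"
    unfolding dual_value_def prod.case using w by (intro INF_lower2[of "((x, y), z)"]) auto
  also have "\<dots> < \<infinity>"
    using w fin[of x] feas_stage_states[of "Suc t" n "(x, y)"] t n by auto
  finally show ?thesis .
qed

text \<open>The induction over iterations contains one that descends the stages, since the cuts at
  stage \<open>t\<close> rest on dual values computed with the new \<open>Q_lo\<close> of stage
  \<open>t + 1\<close>. The lower bound is inherited through the maximum; the upper one needs every
  cut to be below infinity.\<close>

lemma Q_lo_bounds:
  assumes "j \<le> last_iter" "t \<le> horizon P" "x \<in> stage_states P t"
  shows "0 \<le> Q_lo R j t x \<and> Q_lo R j t x < \<infinity>"
  using assms
proof (induction j arbitrary: t x)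
  case 0
  then show ?case using init by (simp add: ddp_init_def)
next
  case (Suc i)
  then have j: "Suc i \<in> iterations" and i: "i \<le> last_iter" by auto
  from Suc.prems(2,3) show ?case
  proof (induction t arbitrary: x rule: inc_induct)
    case base
    then show ?case by simp
  next
    case (step t)
    have x: "x \<in> states P t" using step by (simp add: stage_states_def)
    have "cut P R (Suc i) (Suc t) m x < \<infinity>" if "m \<in> nodes P (Suc t)" for m
      using v_lo_finite[OF j step.hyps(2) that] step.IH by (auto simp: cut_def)
    then have "(\<Sum>m\<in>nodes P (Suc t). ereal (prob P t m) * cut P R (Suc i) (Suc t) m x) \<noteq> \<infinity>"
      using prob_pos[OF problem step.hyps(2)] by (fastforce simp: sum_Pinfty ereal_mult_eq_PInfty)
    then show ?case
      using Q_lo_step[OF j step.hyps(2) x] Suc.IH[OF i, of t x] step.hyps step.prems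
      by (auto simp: max_def less_top)
  qed
qed

text \<open>The forward value, a sum of nonnegative terms, bounds \<open>v_lo\<close> from below,
  and \<open>v_lo_finite\<close> bounds it from above. Real values allow \<open>eps\<close> to be
  split off sums in \<open>backward_resolves\<close>.\<close>

lemma v_lo_real:
  assumes j: "j \<in> iterations" and t: "t < horizon P" and n: "n \<in> nodes P (Suc t)"
  shows "0 \<le> stage_obj P n (state R j t) (Q_lo R (j - 1) (Suc t)) (fwd R j n)"
    and "\<bar>v_lo R j n\<bar> \<noteq> \<infinity>"
proof -
  obtain x y z where w: "fwd R j n = ((x, y), z)" "(x, y) \<in> feas P n" "z \<in> states P t"
    using fwd_arg_min[OF j t n] by (auto simp: is_arg_min_def)
  have "0 \<le> cost P n z y x"
    using cost_nonneg[of "Suc t" n z x y] t n w by (simp add: prev_states_def)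
  moreover have "0 \<le> Q_lo R (j - 1) (Suc t) x"
    using Q_lo_bounds[of "j - 1" "Suc t" x] feas_stage_states[of "Suc t" n "(x, y)"] j t n w by auto
  moreover have "0 \<le> sig P n * pen P n (state R j t - z)"
    using pen_nonneg[OF t n state_in_states[OF j t] w(3)] .
  ultimately show *: "0 \<le> stage_obj P n (state R j t) (Q_lo R (j - 1) (Suc t)) (fwd R j n)"
    using w by (simp add: stage_obj_def)
  have "v_lo R j n < \<infinity>"
    using Q_lo_bounds j t by (intro v_lo_finite[OF j t n]) auto
  then show "\<bar>v_lo R j n\<bar> \<noteq> \<infinity>"
    using order_trans[OF * fwd_value_le_v_lo[OF j t n]] by auto
qed

section \<open>Resolved states\<close>

definition resolved :: "nat \<Rightarrow> nat \<Rightarrow> 'a \<Rightarrow> bool" where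
  "resolved j t x \<longleftrightarrow> Q_up R j t x \<le> Q_lo R j t x + ereal eps"

lemma resolved_mono:
  assumes "resolved j t x" "j \<le> j'" "j' \<le> last_iter" "t \<le> horizon P" "x \<in> stage_states P t"
  shows "resolved j' t x"
  using assms(2,3)
proof (induction j' rule: dec_induct)
  case base
  then show ?case using assms(1) by simp
next
  case (step k)
  then have "Suc k \<in> iterations" by auto
  then have "Q_lo R k t x \<le> Q_lo R (Suc k) t x" "Q_up R (Suc k) t x \<le> Q_up R k t x"
    using Q_lo_mono[of "Suc k" t x] Q_up_antimono[of "Suc k" t x] assms by auto
  then show ?case
    using step unfolding resolved_def by (meson Suc_leD add_right_mono order_trans)
qed

text \<open>The additive form of \<open>resolved\<close> chains well through infinite values, while
  the selection rule compares differences. They agree because \<open>Q_lo\<close> is finite.\<close>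

lemma resolved_iff_gap:
  assumes "j \<le> last_iter" "t \<le> horizon P" "x \<in> stage_states P t"
  shows "resolved j t x \<longleftrightarrow> Q_up R j t x - Q_lo R j t x \<le> ereal eps"
  using Q_lo_bounds[OF assms] unfolding resolved_def
  by (cases "Q_lo R j t x"; cases "Q_up R j t x") auto

text \<open>The linear, penalty and norm terms vanish at the trial state itself, so there the cuts
  average \<open>v_lo\<close> and the upper cut averages \<open>v_up\<close>. Node by node,
  \<open>v_up\<close> exceeds the forward value by at most \<open>eps\<close>, and the forward value
  is at most \<open>v_lo\<close>.\<close>

lemma backward_resolves:
  assumes j: "j \<in> iterations" and t: "t < horizon P"
    and next_resolved: "\<And>n. n \<in> nodes P (Suc t) \<Longrightarrow> resolved (j - 1) (Suc t) (fwd_x R j n)"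
  shows "resolved j t (state R j t)"
proof -
  let ?x = "state R j t"
  have x: "?x \<in> states P t" using j t by (rule state_in_states)
  define v where "v n = real_of_ereal (v_lo R j n)" for n
  have v: "v_lo R j n = ereal (v n)" if "n \<in> nodes P (Suc t)" for n
    unfolding v_def using v_lo_real(2)[OF j t that] by (simp add: ereal_real')
  have up: "v_up P R j (Suc t) n \<le> ereal (v n + eps)" if n: "n \<in> nodes P (Suc t)" for n
  proof -
    obtain x y z where w: "fwd R j n = ((x, y), z)" by (cases "fwd R j n", cases "fst (fwd R j n)") auto
    have "x \<in> stage_states P (Suc t)"
      using fwd_x_stage_states[OF j t n] w by (simp add: fwd_x_def)
    \<comment> \<open>\<open>v_up\<close> evaluates the forward decision with the upper
      approximation of iteration \<open>j\<close>, whereas the hypothesis speaks of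
      \<open>j - 1\<close>.\<close>
    then have "Q_up R j (Suc t) x \<le> Q_up R (j - 1) (Suc t) x"
      using t by (intro Q_up_antimono[OF j]) auto
    also have "\<dots> \<le> Q_lo R (j - 1) (Suc t) x + ereal eps"
      using next_resolved[OF n] w by (simp add: resolved_def fwd_x_def)
    finally have "v_up P R j (Suc t) n \<le>
        stage_obj P n ?x (Q_lo R (j - 1) (Suc t)) (fwd R j n) + ereal eps"
      unfolding v_up_def stage_obj_def w prod.case add.assoc diff_Suc_1
      by (intro add_left_mono)
    also have "\<dots> \<le> v_lo R j n + ereal eps"
      using fwd_value_le_v_lo[OF j t n] by (rule add_right_mono)
    finally show ?thesis using v[OF n] by simp
  qed
  have "Q_up R j t ?x \<le> upper_cut P R j t ?x"
    using Q_up_step[OF j t x] by simp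
  also have "\<dots> = (\<Sum>m\<in>nodes P (Suc t). ereal (prob P t m) * v_up P R j (Suc t) m)"
    using nrm_zero[OF t] by (simp add: upper_cut_def zero_ereal_def[symmetric])
  also have "\<dots> \<le> (\<Sum>m\<in>nodes P (Suc t). ereal (prob P t m) * ereal (v m + eps))"
    using up prob_pos[OF problem t] by (intro sum_mono ereal_mult_left_mono) (auto simp: less_imp_le)
  \<comment> \<open>The probabilities sum to one, so averaging keeps \<open>eps\<close>.\<close>
  also have "\<dots> = (\<Sum>m\<in>nodes P (Suc t). ereal (prob P t m) * ereal (v m)) + ereal eps"
    using sum_prob[OF t] by (simp add: distrib_left sum.distrib sum_distrib_right[symmetric])
  also have "(\<Sum>m\<in>nodes P (Suc t). ereal (prob P t m) * ereal (v m)) =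
      (\<Sum>m\<in>nodes P (Suc t). ereal (prob P t m) * cut P R j (Suc t) m ?x)"
    using v pen_zero[OF t] by (intro sum.cong) (auto simp: cut_def)
  also have "\<dots> \<le> Q_lo R j t ?x"
    using Q_lo_step[OF j t x] by simp
  finally show ?thesis unfolding resolved_def by (simp add: add_right_mono)
qed

text \<open>The preceding root step takes \<open>LB\<close> and a candidate for \<open>UB\<close> at
  this very root solution. Were its state resolved, the bounds would be within \<open>eps\<close>
  and iteration \<open>j\<close> would not start.\<close>

lemma root_unresolved:
  assumes j: "j \<in> iterations"
  shows "\<not> resolved (j - 1) 0 (state R j 0)"
proof
  assume res: "resolved (j - 1) 0 (state R j 0)"
  \<comment> \<open>Initially the upper approximation is infinite, so no root state is resolved;
    hence a preceding root step exists.\<close>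
  have "j \<noteq> 1"
    using res init horizon_pos by (auto simp: resolved_def ddp_init_def)
  then have j': "j - 1 \<in> iterations" "j - 1 + 1 = j" using j by auto
  let ?c = "cost P (root P) 0 (y_root R j) (state R j 0)"
  let ?Q = "Q_lo R (j - 1) 0"
  have min: "is_arg_min (root_obj P ?Q) (\<lambda>w. w \<in> feas P (root P)) (state R j 0, y_root R j)"
    and LB: "LB R (j - 1) = ?c + ?Q (state R j 0)"
    using root_arg_min[OF j] by (auto simp: root_obj_def)
  have "UB R (j - 1) \<le> ?c + Q_up R (j - 1) 0 (state R j 0)"
    using root_step[OF j'(1)] j'(2) by (auto simp: ddp_root_step_def Let_def root_obj_def split: if_splits)
  also have "\<dots> \<le> ?c + (?Q (state R j 0) + ereal eps)"
    using res unfolding resolved_def by (rule add_left_mono)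
  finally have UB: "UB R (j - 1) \<le> LB R (j - 1) + ereal eps"
    unfolding LB by (simp add: add.assoc)
  \<comment> \<open>\<open>LB\<close> must be finite before it is subtracted: infinity minus
    infinity is infinity in \<open>ereal\<close>.\<close>
  obtain x y z where w: "(x, y) \<in> feas P (root P)" "z \<in> prev_states P 0"
      "cost P (root P) z y x < \<infinity>"
    using finite_cost_decision[OF problem _ root_in] by auto
  have "LB R (j - 1) \<le> cost P (root P) 0 y x + ?Q x"
    using min w LB by (force simp: is_arg_min_linorder root_obj_def)
  also have "\<dots> < \<infinity>"
    using w Q_lo_bounds[of "j - 1" 0 x] feas_stage_states[of 0 "root P" "(x, y)"] j j' root_in
    by (auto simp: prev_states_def)
  finally have "LB R (j - 1) < \<infinity>" .
  moreover have "0 \<le> LB R (j - 1)"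
    using LB cost_nonneg[OF _ root_in, of 0] min Q_lo_bounds[of "j - 1" 0 "state R j 0"]
      state_in_states[OF j horizon_pos] j horizon_pos
    by (auto simp: prev_states_def stage_states_def is_arg_min_def)
  ultimately have "UB R (j - 1) - LB R (j - 1) \<le> ereal eps"
    using UB by (cases "LB R (j - 1)"; cases "UB R (j - 1)") auto
  then show False using not_stopped[OF j] by simp
qed

section \<open>New resolved pairs in each iteration, and their count\<close>

lemma iteration_resolves_new:
  assumes j: "j \<in> iterations"
  shows "\<exists>t<horizon P. \<not> resolved (j - 1) t (state R j t) \<and> resolved j t (state R j t)"
proof -
  let ?bad = "\<lambda>t. t < horizon P \<and> \<not> resolved (j - 1) t (state R j t)"
  \<comment> \<open>Trial states of iteration \<open>j\<close> are tested against the approximations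
    of \<open>j - 1\<close>. Stage 0 is always unresolved, so a last unresolved stage
    exists.\<close>
  define t where "t = (GREATEST t. ?bad t)"
  have bad0: "?bad 0" using root_unresolved[OF j] horizon_pos by simp
  have t: "?bad t"
    unfolding t_def by (rule GreatestI_nat[of ?bad 0 "horizon P"]) (use bad0 in auto)
  have max: "s \<le> t" if "?bad s" for s
    unfolding t_def by (rule Greatest_le_nat[of ?bad s "horizon P"]) (use that in auto)
  have "resolved (j - 1) (Suc t) (fwd_x R j n)" if n: "n \<in> nodes P (Suc t)" for n
  proof (cases "Suc t = horizon P")
    case True
    then show ?thesis using eps_pos by (simp add: resolved_def)
  next
    case False
    then have Suc_t: "Suc t < horizon P" using t by auto
    \<comment> \<open>The selected \<open>m\<close> has the largest gap, measured with the
      approximations of \<open>j - 1\<close>. Its state is resolved because \<open>t\<close> is the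
      last unresolved stage, so every other gap is at most \<open>eps\<close> too.\<close>
    obtain m where m: "m \<in> nodes P (Suc t)" "state R j (Suc t) = fwd_x R j m"
        "\<And>n. n \<in> nodes P (Suc t) \<Longrightarrow> gap R j (Suc t) n \<le> gap R j (Suc t) m"
      using bspec[OF conjunct2[OF forward[OF j, unfolded ddp_forward_def]], of "Suc t"] Suc_t
      by auto
    have iff: "resolved (j - 1) (Suc t) (fwd_x R j k) \<longleftrightarrow> gap R j (Suc t) k \<le> ereal eps"
      if "k \<in> nodes P (Suc t)" for k
      unfolding gap_def using fwd_x_stage_states[OF j _ that] t j by (intro resolved_iff_gap) auto
    have "resolved (j - 1) (Suc t) (fwd_x R j m)"
      using max[of "Suc t"] Suc_t m(2) by auto
    then show ?thesis
      using iff m n by (meson order_trans)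
  qed
  then show ?thesis using backward_resolves[OF j] t by auto
qed

text \<open>Sending each iteration to a pair that it newly resolves is injective into the pairs of
  stage and state, of which there are at most \<open>horizon P * K\<close>.\<close>

lemma iterations_bound:
  assumes card: "\<And>t. t < horizon P \<Longrightarrow> card (states P t) \<le> K"
  shows "last_iter \<le> horizon P * K"
proof -
  obtain f where f: "\<And>j. j \<in> iterations \<Longrightarrow> f j < horizon P \<and>
      \<not> resolved (j - 1) (f j) (state R j (f j)) \<and> resolved j (f j) (state R j (f j))"
    using iteration_resolves_new by metis
  let ?p = "\<lambda>j. (f j, state R j (f j))"
  let ?S = "SIGMA t:{..<horizon P}. states P t"
  have "j = k" if jk: "j \<in> iterations" "k \<in> iterations" "?p j = ?p k" for j k
  proof (rule linorder_cases[of j k])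
    \<comment> \<open>From \<open>j < k\<close> follows \<open>j \<le> k - 1\<close>, so the pair
      resolved in iteration \<open>j\<close> is still resolved when iteration \<open>k\<close>
      begins, contrary to the choice of \<open>f k\<close>.\<close>
    have False if "j < k" "j \<in> iterations" "k \<in> iterations" "?p j = ?p k" for j k
    proof -
      have "f j < horizon P" "resolved j (f j) (state R j (f j))" using f[OF that(2)] by auto
      moreover from this have "state R j (f j) \<in> stage_states P (f j)"
        using state_in_states[OF that(2)] by (simp add: stage_states_def)
      ultimately have "resolved (k - 1) (f j) (state R j (f j))"
        using that(1,3) by (intro resolved_mono[of j _ _ "k - 1"]) auto
      moreover have "f j = f k" "state R j (f j) = state R k (f k)" using that(4) by blast+
      ultimately show False using f[OF that(3)] by metis
    qed
    then show "j < k \<Longrightarrow> j = k" "k < j \<Longrightarrow> j = k" using jk by metis+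
  qed
  then have "inj_on ?p iterations" by (intro inj_onI) blast
  moreover have "?p ` iterations \<subseteq> ?S"
    using f state_in_states by auto
  moreover have "finite ?S"
    using finite_states by auto
  ultimately have "last_iter \<le> card ?S"
    using card_inj_on_le[of ?p iterations ?S] by simp
  also have "\<dots> = (\<Sum>t<horizon P. card (states P t))"
    using finite_states by simp
  also have "\<dots> \<le> horizon P * K"
    using sum_bounded_above[of "{..<horizon P}" "\<lambda>t. card (states P t)" K] card by simp
  finally show ?thesis .
qed

end

theorem corollary3:
  fixes P :: "('n, 'a::euclidean_space, 'b::euclidean_space) msp"
    and R :: "('n, 'a, 'b) ddp_run"
    and K i :: nat
    and eps :: real
  assumes "msp_problem P"
    and "regularization P"
    and "exact_regularization P"
    and "dual_bounds P"
    and "0 < K"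
    and "\<forall>t<horizon P. finite (states P t) \<and> card (states P t) \<le> K"
    and "0 < eps"
    and "ddp_terminates P eps R i"
    and "eps_optimal_root P eps (incumbent R i)"
  shows "i \<le> horizon P * K"
proof -
  interpret finite_state_run P R i eps
    using assms by unfold_locales auto
  show ?thesis using assms by (intro iterations_bound) auto
qed

end
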